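(* Let $\mathfrak{l}$ be a finite dimensional complex elementary quadratic Lie algebra with bilinear form $B$ and with non zero totally isotropic center $Z(\mathfrak{l})$. Then: (1) If $\dim(\mathfrak{l})=6$, there exists a basis $\{Z_1,Z_2,Z_3,X_1,X_2,X_3\}$ of $\mathfrak{l}$ such that: (i) $\{Z_1,Z_2,Z_3\}$ is a basis of $Z(\mathfrak{l})$; (ii) $B(Z_i,Z_j)=B(X_i,X_j)=0$, $B(Z_i,X_j)=\delta_{ij}$ for all $i,j$; (iii) $[X_1,X_2]=Z_3$, $[X_2,X_3]=Z_1$, $[X_3,X_1]=Z_2$ and the other brackets vanish. (2) If $\dim(\mathfrak{l})=5$, there exists a basis $\{Z_1,Z_2,X_1,X_2,T\}$ of $\mathfrak{l}$ such that: (i) $\{Z_1,Z_2\}$ is a basis of $Z(\mathfrak{l})$; (ii) $B(Z_i,Z_j)=B(X_i,X_j)=0$, $B(Z_i,X_j)=\delta_{ij}$ for all $i,j$, $B(T,Z_i)=B(T,X_i)=0$, $B(T,T)=1$; (iii) $[X_1,T]=-Z_2$, $[X_2,T]=Z_1$, $[X_1,X_2]=T$ and the other brackets vanish. (3) If $\dim(\mathfrak{l})=4$, then $\dim(Z(\mathfrak{l}))=1$ and there exist totally isotropic subspaces $\mathfrak{i}$ with basis $\{Z,P\}$ and $\mathfrak{i}'$ with basis $\{X,Q\}$ such that $Z(\mathfrak{l})\subset\mathfrak{i}\subset[\mathfrak{l},\mathfrak{l}]$, $\mathfrak{l}=\mathfrak{i}\oplus\mathfrak{i}'$ and: (i) $Z(\mathfrak{l})=\mathbb{C}Z$,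 $B(Z,X)=B(P,Q)=1$, $B(Z,Q)=B(X,P)=0$; (ii) $[X,P]=P$, $[X,Q]=-Q$, $[P,Q]=Z$ and the other brackets vanish.
   Context: A quadratic Lie algebra is a Lie algebra with a non degenerate symmetric invariant bilinear form $B$. $Z(\mathfrak{l})$ denotes the center of $\mathfrak{l}$. $\mathfrak{l}$ is called elementary if the skew symmetric trilinear form $I_{\mathfrak{l}}(X,Y,Z)=B([X,Y],Z)$ is decomposable, i.e. $I_{\mathfrak{l}}=\omega_1\wedge\omega_2\wedge\omega_3$ with $\omega_1,\omega_2,\omega_3\in\mathfrak{l}^*$. A subspace is totally isotropic if $B$ vanishes identically on it. "The other brackets vanish" refers to brackets of basis elements not determined by the listed ones via skew symmetry. *)

theory Defs
  imports Complex_Main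
begin

locale lie_algebra = vector_space scale
  for scale :: "'k::field \<Rightarrow> 'v::ab_group_add \<Rightarrow> 'v" +
  fixes br :: "'v \<Rightarrow> 'v \<Rightarrow> 'v"
  assumes br_linear_left: "Vector_Spaces.linear scale scale (\<lambda>x. br x y)"
    and br_linear_right: "Vector_Spaces.linear scale scale (\<lambda>y. br x y)"
    and br_alternating: "br x x = 0"
    and jacobi: "br x (br y z) + br y (br z x) + br z (br x y) = 0"
begin

definition center :: "'v set" where
  "center = {x. \<forall>y. br x y = 0}"

definition derived :: "'v set" where
  "derived = span {br x y | x y. True}"

text \<open>Bases are given as lists, so that the listed vectors are required to be
  pairwise distinct.\<close>

definition basis_of :: "'v set \<Rightarrow> 'v list \<Rightarrow> bool" where
  "basis_of W vs \<longleftrightarrow> distinct vs \<and> independent (set vs) \<and> span (set vs) = W"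

definition direct_sum :: "'v set \<Rightarrow> 'v set \<Rightarrow> 'v set \<Rightarrow> bool" where
  "direct_sum V U W \<longleftrightarrow>
     subspace U \<and> subspace W \<and> U \<inter> W = {0} \<and> V = {u + w | u w. u \<in> U \<and> w \<in> W}"

end

text \<open>The exterior product of three linear forms, evaluated on three vectors, with the
  convention that it is the determinant of the matrix of values (no factor 1/6).
  Decomposability of a trilinear form over the complex numbers does not depend on this
  normalization.\<close>

definition wedge3 ::
  "('v \<Rightarrow> 'k::comm_ring) \<Rightarrow> ('v \<Rightarrow> 'k) \<Rightarrow> ('v \<Rightarrow> 'k) \<Rightarrow> 'v \<Rightarrow> 'v \<Rightarrow> 'v \<Rightarrow> 'k" where
  "wedge3 f g h x y z =
     f x * g y * h z + f y * g z * h x + f z * g x * h y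
     - f x * g z * h y - f y * g x * h z - f z * g y * h x"

locale quadratic_lie_algebra = lie_algebra scale br
  for scale :: "'k::field \<Rightarrow> 'v::ab_group_add \<Rightarrow> 'v" and br :: "'v \<Rightarrow> 'v \<Rightarrow> 'v" +
  fixes B :: "'v \<Rightarrow> 'v \<Rightarrow> 'k"
  assumes form_linear_left: "Vector_Spaces.linear scale (*) (\<lambda>x. B x y)"
    and form_linear_right: "Vector_Spaces.linear scale (*) (\<lambda>y. B x y)"
    and form_sym: "B x y = B y x"
    and form_invariant: "B (br x y) z = B x (br y z)"
    and form_nondegenerate: "(\<forall>y. B x y = 0) \<Longrightarrow> x = 0"
begin

definition elementary :: bool where
  "elementary \<longleftrightarrow>
     (\<exists>\<omega>\<^sub>1 \<omega>\<^sub>2 \<omega>\<^sub>3.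
        Vector_Spaces.linear scale (*) \<omega>\<^sub>1 \<and>
        Vector_Spaces.linear scale (*) \<omega>\<^sub>2 \<and>
        Vector_Spaces.linear scale (*) \<omega>\<^sub>3 \<and>
        (\<forall>x y z. B (br x y) z = wedge3 \<omega>\<^sub>1 \<omega>\<^sub>2 \<omega>\<^sub>3 x y z))"

definition totally_isotropic :: "'v set \<Rightarrow> bool" where
  "totally_isotropic W \<longleftrightarrow> subspace W \<and> (\<forall>x\<in>W. \<forall>y\<in>W. B x y = 0)"

end

end

theory Submission
  imports Defs
begin

text \<open>
  Represent the three forms by vectors \<open>a\<close>, \<open>b\<close>, \<open>c\<close>. These span the derived algebra, whose
  orthogonal complement is the center; since the center is totally isotropic, it lies in this
  three-dimensional span and is its radical, of dimension \<open>dim L - 3\<close>. Passing to another basis of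
  the span only multiplies the trilinear form by the determinant, which is absorbed by rescaling a
  central vector. It remains to choose the basis well in the span modulo its radical (nothing to do,
  a unit vector, or a hyperbolic pair) and to correct dual vectors by central ones to make them
  isotropic.
\<close>

section \<open>Determinants of linear forms\<close>

lemma wedge3_rotate: "wedge3 f g h x y z = wedge3 g h f x y z"
  by (simp add: wedge3_def algebra_simps)

text \<open>The witness is the determinant of the coefficient matrix, by multiplicativity of
  determinants. That it is non-zero is established only in \<open>frame_change\<close>.\<close>

lemma wedge3_linear_combination:
  fixes f g h :: "'v \<Rightarrow> 'k::field"
  shows "\<exists>c. \<forall>x y z.
    wedge3 (\<lambda>x. a1 * f x + a2 * g x + a3 * h x) (\<lambda>x. b1 * f x + b2 * g x + b3 * h x)
           (\<lambda>x. c1 * f x + c2 * g x + c3 * h x) x y z = c * wedge3 f g h x y z"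
  by (rule exI[of _ "a1 * b2 * c3 + a2 * b3 * c1 + a3 * b1 * c2
                     - a1 * b3 * c2 - a2 * b1 * c3 - a3 * b2 * c1"])
     (simp add: wedge3_def algebra_simps)

context vector_space
begin

lemma linear_form:
  assumes "Vector_Spaces.linear scale (*) f"
  shows "f (x + y) = f x + f y" "f (scale r x) = r * f x"
proof -
  interpret Vector_Spaces.linear scale "(*)" f by fact
  show "f (x + y) = f x + f y" "f (scale r x) = r * f x"
    by (fact add scale)+
qed

text \<open>Cramer's rule: \<open>w\<close> combines \<open>x\<close>, \<open>y\<close>,
  \<open>z\<close> with the cofactors of the values of \<open>f\<close>. So \<open>f w\<close> is
  the full determinant, while \<open>g w\<close> and \<open>h w\<close> are determinants with a
  repeated row.\<close>

lemma wedge3_dual_vector: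
  assumes lin: "Vector_Spaces.linear scale (*) f" "Vector_Spaces.linear scale (*) g"
      "Vector_Spaces.linear scale (*) h"
    and nz: "wedge3 f g h x y z \<noteq> 0"
  shows "\<exists>u. f u = 1 \<and> g u = 0 \<and> h u = 0"
proof -
  note simps = lin[THEN linear_form(1)] lin[THEN linear_form(2)]
  define w where "w = scale (g y * h z - g z * h y) x + scale (g z * h x - g x * h z) y
                      + scale (g x * h y - g y * h x) z"
  have "f w = wedge3 f g h x y z" "g w = 0" "h w = 0"
    unfolding w_def simps by (simp_all add: wedge3_def algebra_simps)
  then have "f (scale (inverse (wedge3 f g h x y z)) w) = 1
      \<and> g (scale (inverse (wedge3 f g h x y z)) w) = 0
      \<and> h (scale (inverse (wedge3 f g h x y z)) w) = 0"
    using nz by (simp add: simps)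
  then show ?thesis by blast
qed

lemma span_three: "x \<in> span {a, b, c} \<longleftrightarrow> (\<exists>k l m. x = scale k a + scale l b + scale m c)"
proof
  assume "x \<in> span {a, b, c}"
  then obtain k l m where "x - scale k a - scale l b - scale m c = 0"
    by (auto simp: span_breakdown_eq)
  then have "x = scale k a + scale l b + scale m c" by (simp add: algebra_simps)
  then show "\<exists>k l m. x = scale k a + scale l b + scale m c" by blast
next
  assume "\<exists>k l m. x = scale k a + scale l b + scale m c"
  then show "x \<in> span {a, b, c}"
    by (auto intro!: span_add span_scale intro: span_base)
qed

lemma span_two: "x \<in> span {a, b} \<longleftrightarrow> (\<exists>k l. x = scale k a + scale l b)"
proof -
  have "{a, b} = {a, b, b}" by auto
  then have "x \<in> span {a, b} \<longleftrightarrow> (\<exists>k l m. x = scale k a + scale l b + scale m b)"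
    by (simp only: span_three)
  also have "\<dots> \<longleftrightarrow> (\<exists>k l. x = scale k a + scale l b)"
  proof safe
    fix k l m
    show "\<exists>k' l'. scale k a + scale l b + scale m b = scale k' a + scale l' b"
      by (rule exI[of _ k], rule exI[of _ "l + m"]) (simp add: scale_left_distrib add.assoc)
  next
    fix k l
    show "\<exists>k' l' m'. scale k a + scale l b = scale k' a + scale l' b + scale m' b"
      by (rule exI[of _ k], rule exI[of _ l], rule exI[of _ 0]) simp
  qed
  finally show ?thesis .
qed

end

section \<open>The invariant form and dual families\<close>

context quadratic_lie_algebra
begin

lemma form_simps:
  "B (x + y) z = B x z + B y z" "B (x - y) z = B x z - B y z" "B (scale r x) z = r * B x z"
  "B 0 z = 0" "B z (x + y) = B z x + B z y" "B z (x - y) = B z x - B z y"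
  "B z (scale r x) = r * B z x" "B z 0 = 0" "B z (sum f S) = (\<Sum>s\<in>S. B z (f s))"
proof -
  interpret left: Vector_Spaces.linear scale "(*)" "\<lambda>x. B x z" by (rule form_linear_left)
  interpret right: Vector_Spaces.linear scale "(*)" "B z" by (rule form_linear_right)
  show "B (x + y) z = B x z + B y z" "B (x - y) z = B x z - B y z" "B (scale r x) z = r * B x z"
    "B 0 z = 0" "B z (x + y) = B z x + B z y" "B z (x - y) = B z x - B z y"
    "B z (scale r x) = r * B z x" "B z 0 = 0" "B z (sum f S) = (\<Sum>s\<in>S. B z (f s))"
    by (fact left.add left.diff left.scale left.zero
      right.add right.diff right.scale right.zero right.sum)+
qed

lemma br_simps:
  "br (x + y) z = br x z + br y z" "br (scale r x) z = scale r (br x z)" "br 0 z = 0"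
proof -
  interpret Vector_Spaces.linear scale scale "\<lambda>x. br x z" by (rule br_linear_left)
  show "br (x + y) z = br x z + br y z" "br (scale r x) z = scale r (br x z)" "br 0 z = 0"
    by (fact add scale zero)+
qed

lemma form_eqI: "(\<And>v. B x v = B y v) \<Longrightarrow> x = y"
  using form_nondegenerate[of "x - y"] by (simp add: form_simps)

lemma center_subspace: "subspace center"
  by (rule subspaceI) (auto simp: center_def br_simps)

text \<open>Pairing a vanishing combination with \<open>ws ! i\<close> isolates the coefficient of
  \<open>vs ! i\<close>; equal entries at two positions would pair to both 1 and 0 with the same
  vector.\<close>

lemma independent_if_dual:
  assumes dual: "\<And>i j. i < length vs \<Longrightarrow> j < length vs \<Longrightarrow>
    B (ws ! i) (vs ! j) = (if i = j then 1 else 0)"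
  shows "distinct vs" "independent (set vs)"
proof -
  show dist: "distinct vs"
    unfolding distinct_conv_nth using dual by (metis one_neq_zero)
  show "independent (set vs)"
    unfolding dependent_finite[OF finite_set]
  proof safe
    fix u v assume s: "(\<Sum>v\<in>set vs. scale (u v) v) = 0" and v: "v \<in> set vs" "u v \<noteq> 0"
    obtain i where i: "i < length vs" "v = vs ! i" using v(1) by (auto simp: in_set_conv_nth)
    have "0 = B (ws ! i) (\<Sum>v\<in>set vs. scale (u v) v)" by (simp add: s form_simps)
    also have "\<dots> = (\<Sum>w\<in>set vs. u w * B (ws ! i) w)"
      by (simp add: form_simps)
    also have "\<dots> = (\<Sum>w\<in>set vs. if w = v then u v else 0)"
    proof (rule sum.cong[OF refl])
      fix w assume "w \<in> set vs"
      then obtain j where j: "j < length vs" "w = vs ! j" by (auto simp: in_set_conv_nth)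
      show "u w * B (ws ! i) w = (if w = v then u v else 0)"
        using dual[OF i(1) j(1)] i j dist by (auto simp: nth_eq_iff_index_eq)
    qed
    also have "\<dots> = u v" using v by simp
    finally show False using v by simp
  qed
qed

section \<open>Representing the trilinear form by three vectors\<close>

text \<open>The decomposing forms are replaced by vectors representing them through
  \<open>B\<close>, which can then be compared with the center.\<close>

definition frame :: "'v \<Rightarrow> 'v \<Rightarrow> 'v \<Rightarrow> bool" where
  "frame a b c \<longleftrightarrow> (\<forall>x y z. B (br x y) z = wedge3 (B a) (B b) (B c) x y z)"

text \<open>The two triples may share vectors: in dimension five \<open>t\<close> becomes its own
  dual, in dimension four \<open>p\<close> and \<open>q\<close> become dual to each other.\<close>

definition dual3 :: "'v \<Rightarrow> 'v \<Rightarrow> 'v \<Rightarrow> 'v \<Rightarrow> 'v \<Rightarrow> 'v \<Rightarrow> bool" where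
  "dual3 a b c d e f \<longleftrightarrow> B a d = 1 \<and> B a e = 0 \<and> B a f = 0
     \<and> B b d = 0 \<and> B b e = 1 \<and> B b f = 0 \<and> B c d = 0 \<and> B c e = 0 \<and> B c f = 1"

text \<open>Nondegeneracy recovers the bracket from the trilinear form, in the shape of a cross
  product. Hence all brackets lie in the span of the frame and are computed from values of
  \<open>B\<close>.\<close>

lemma br_frame:
  assumes "frame a b c"
  shows "br x y = scale (B b x * B c y - B c x * B b y) a + scale (B c x * B a y - B a x * B c y) b
    + scale (B a x * B b y - B b x * B a y) c"
  by (rule form_eqI)
     (simp add: assms[unfolded frame_def, rule_format] wedge3_def form_simps algebra_simps)

text \<open>The representing vectors are explicit: for \<open>p\<close>, \<open>q\<close>,
  \<open>r\<close> dual to \<open>f\<close>, \<open>g\<close>, \<open>h\<close>, the determinant at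
  \<open>q\<close>, \<open>r\<close>, \<open>z\<close> reduces to \<open>f z\<close>, so
  \<open>br q r\<close> represents \<open>f\<close>, and cyclically.\<close>

lemma frame_if_elementary:
  assumes elementary and "br x0 y0 \<noteq> 0"
  shows "\<exists>a b c. frame a b c"
proof -
  obtain f g h where lin: "Vector_Spaces.linear scale (*) f" "Vector_Spaces.linear scale (*) g"
      "Vector_Spaces.linear scale (*) h"
    and I: "\<And>x y z. B (br x y) z = wedge3 f g h x y z"
    using assms(1) unfolding elementary_def by blast
  obtain z0 where nz: "wedge3 f g h x0 y0 z0 \<noteq> 0"
    using assms(2) form_nondegenerate[of "br x0 y0"] by (auto simp: I)
  obtain p where p: "f p = 1" "g p = 0" "h p = 0"
    using wedge3_dual_vector[OF lin nz] by blast
  obtain q where q: "f q = 0" "g q = 1" "h q = 0"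
    using wedge3_dual_vector[OF lin(2,3,1)] nz by (metis wedge3_rotate)
  obtain r where r: "f r = 0" "g r = 0" "h r = 1"
    using wedge3_dual_vector[OF lin(3,1,2)] nz by (metis wedge3_rotate)
  have "B (br q r) = f" "B (br r p) = g" "B (br p q) = h"
    using p q r by (auto simp: I wedge3_def fun_eq_iff)
  then have "frame (br q r) (br r p) (br p q)" by (simp add: frame_def I)
  then show ?thesis by blast
qed

lemma dual3_if_frame:
  assumes "frame a b c" and "br x0 y0 \<noteq> 0"
  shows "\<exists>d e f. dual3 a b c d e f"
proof -
  obtain z0 where nz: "wedge3 (B a) (B b) (B c) x0 y0 z0 \<noteq> 0"
    using assms form_nondegenerate[of "br x0 y0"] by (auto simp: frame_def)
  note lin = form_linear_right[of a] form_linear_right[of b] form_linear_right[of c]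
  obtain d where d: "B a d = 1" "B b d = 0" "B c d = 0"
    using wedge3_dual_vector[OF lin nz] by blast
  obtain e where e: "B a e = 0" "B b e = 1" "B c e = 0"
    using wedge3_dual_vector[OF lin(2,3,1)] nz by (metis wedge3_rotate)
  obtain f where f: "B a f = 0" "B b f = 0" "B c f = 1"
    using wedge3_dual_vector[OF lin(3,1,2)] nz by (metis wedge3_rotate)
  show ?thesis using d e f unfolding dual3_def by blast
qed

text \<open>Evaluating the determinant at a central \<open>x\<close> and two of the dual vectors
  leaves the third form at \<open>x\<close>, which must vanish. The converse is
  \<open>br_frame\<close>.\<close>

lemma center_frame:
  assumes fr: "frame a b c" and du: "dual3 a b c d e f"
  shows "center = {x. B a x = 0 \<and> B b x = 0 \<and> B c x = 0}"
proof safe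
  fix x assume "x \<in> center"
  then have "B (br x y) z = 0" for y z by (simp add: center_def form_simps)
  then have *: "wedge3 (B a) (B b) (B c) x y z = 0" for y z using fr by (simp add: frame_def)
  show "B a x = 0" "B b x = 0" "B c x = 0"
    using *[of e f] *[of f d] *[of d e] du by (simp_all add: wedge3_def dual3_def)
next
  fix x assume "B a x = 0" "B b x = 0" "B c x = 0"
  then show "x \<in> center" by (simp add: center_def br_frame[OF fr])
qed

text \<open>Removing the components along the dual vectors leaves a vector orthogonal to the frame:
  a projection onto the center.\<close>

lemma minus_dual_in_center:
  assumes "frame a b c" and "dual3 a b c d e f"
  shows "v - scale (B a v) d - scale (B b v) e - scale (B c v) f \<in> center"
  using assms(2) by (simp add: center_frame[OF assms] dual3_def form_simps)

text \<open>A central \<open>z\<close> is orthogonal to the center by isotropy, so by the projection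
  \<open>B z v\<close> depends only on the values of the three frame forms at
  \<open>v\<close>.\<close>

lemma center_subset_span_frame:
  assumes fr: "frame a b c" and du: "dual3 a b c d e f" and iso: "totally_isotropic center"
  shows "center \<subseteq> span {a, b, c}"
proof
  fix z assume z: "z \<in> center"
  have "z = scale (B z d) a + scale (B z e) b + scale (B z f) c"
  proof (rule form_eqI)
    fix v
    have "B z (v - scale (B a v) d - scale (B b v) e - scale (B c v) f) = 0"
      using iso z minus_dual_in_center[OF fr du] by (simp add: totally_isotropic_def)
    then show "B z v = B (scale (B z d) a + scale (B z e) b + scale (B z f) c) v"
      by (simp add: form_simps algebra_simps)
  qed
  then show "z \<in> span {a, b, c}" unfolding span_three by blast
qed

text \<open>The determinant \<open>k\<close> of the change of vectors is absorbed into the first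
  one; \<open>k = 0\<close> would make the bracket vanish.\<close>

lemma frame_change:
  assumes fr: "frame a b c" and "br x0 y0 \<noteq> 0"
    and mem: "a \<in> span {a', b', c'}" "b \<in> span {a', b', c'}" "c \<in> span {a', b', c'}"
  shows "\<exists>k. k \<noteq> 0 \<and> frame (scale k a') b' c'"
proof -
  obtain a1 a2 a3 where a: "a = scale a1 a' + scale a2 b' + scale a3 c'"
    using mem(1) unfolding span_three by blast
  obtain b1 b2 b3 where b: "b = scale b1 a' + scale b2 b' + scale b3 c'"
    using mem(2) unfolding span_three by blast
  obtain c1 c2 c3 where c: "c = scale c1 a' + scale c2 b' + scale c3 c'"
    using mem(3) unfolding span_three by blast
  have forms: "B a = (\<lambda>x. a1 * B a' x + a2 * B b' x + a3 * B c' x)"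
    "B b = (\<lambda>x. b1 * B a' x + b2 * B b' x + b3 * B c' x)"
    "B c = (\<lambda>x. c1 * B a' x + c2 * B b' x + c3 * B c' x)"
    by (simp_all add: a b c form_simps fun_eq_iff)
  have "\<exists>k. \<forall>x y z.
      wedge3 (B a) (B b) (B c) x y z = k * wedge3 (B a') (B b') (B c') x y z"
    unfolding forms by (rule wedge3_linear_combination)
  then obtain k where k: "wedge3 (B a) (B b) (B c) x y z = k * wedge3 (B a') (B b') (B c') x y z"
    for x y z by blast
  have "wedge3 (B (scale k a')) (B b') (B c') x y z = k * wedge3 (B a') (B b') (B c') x y z"
    for x y z
    by (simp add: wedge3_def form_simps algebra_simps)
  then have fr': "frame (scale k a') b' c'"
    using fr unfolding frame_def k by simp
  moreover have "k \<noteq> 0"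
    using br_frame[OF fr', of x0 y0] assms(2) by (auto simp: form_simps)
  ultimately show ?thesis by blast
qed

end

section \<open>Non-zero totally isotropic center: dimension count\<close>

locale isotropic_center = quadratic_lie_algebra scale br B +
    finite_dimensional_vector_space scale Basis
  for scale :: "complex \<Rightarrow> 'v::ab_group_add \<Rightarrow> 'v" (infixr "*s" 75)
    and br :: "'v \<Rightarrow> 'v \<Rightarrow> 'v" and B :: "'v \<Rightarrow> 'v \<Rightarrow> complex" and Basis :: "'v set" +
  assumes elementary: elementary
    and center_nonzero: "center \<noteq> {0}"
    and center_isotropic: "totally_isotropic center"
begin

text \<open>An abelian algebra would be its own center, hence isotropic, hence zero by
  nondegeneracy, against the non-zero center.\<close>

lemma br_nonzero: "\<exists>x y. br x y \<noteq> 0"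
proof (rule ccontr)
  assume "\<not> ?thesis"
  then have "center = UNIV" by (auto simp: center_def)
  then have "x = 0" for x :: 'v
    using center_isotropic form_nondegenerate[of x] by (simp add: totally_isotropic_def)
  then show False using center_nonzero subspace_0[OF center_subspace] by blast
qed

lemma dual3_obtain:
  assumes "frame a b c"
  obtains d e f where "dual3 a b c d e f"
  using dual3_if_frame[OF assms] br_nonzero by blast

lemma dual3_dim:
  assumes "dual3 a b c d e f"
  shows "dim {d, e, f} = 3" "dim {a, b, c} = 3"
proof -
  have "distinct [d, e, f] \<and> independent (set [d, e, f])"
    using assms
    by (intro conjI independent_if_dual[of "[d, e, f]" "[a, b, c]"])
       (auto simp: dual3_def less_Suc_eq)
  then show "dim {d, e, f} = 3" using dim_eq_card_independent[of "{d, e, f}"] by simp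
  have "distinct [a, b, c] \<and> independent (set [a, b, c])"
    using assms
    by (intro conjI independent_if_dual[of "[a, b, c]" "[d, e, f]"])
       (auto simp: dual3_def less_Suc_eq form_sym[of d a] form_sym[of d b] form_sym[of d c]
         form_sym[of e a] form_sym[of e b] form_sym[of e c] form_sym[of f a] form_sym[of f b]
         form_sym[of f c])
  then show "dim {a, b, c} = 3" using dim_eq_card_independent[of "{a, b, c}"] by simp
qed

text \<open>The algebra is the direct sum of the center and the span of a dual triple.\<close>

lemma dim_center_frame:
  assumes fr: "frame a b c"
  shows "dim center + 3 = dim (UNIV :: 'v set)"
proof -
  obtain d e f where du: "dual3 a b c d e f" using dual3_obtain[OF fr] .
  have "v \<in> {x + y |x y. x \<in> center \<and> y \<in> span {d, e, f}}" for v
  proof -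
    have "v = (v - B a v *s d - B b v *s e - B c v *s f)
        + (B a v *s d + B b v *s e + B c v *s f)" by simp
    then show ?thesis
      using minus_dual_in_center[OF fr du, of v] span_three[of _ d e f] by blast
  qed
  then have "{x + y |x y. x \<in> center \<and> y \<in> span {d, e, f}} = UNIV" by blast
  moreover have "center \<inter> span {d, e, f} = {0}"
  proof -
    have "x = 0" if "x \<in> center" "x \<in> span {d, e, f}" for x
      using that du by (auto simp: center_frame[OF fr du] span_three dual3_def form_simps)
    then show ?thesis using subspace_0[OF center_subspace] span_zero by blast
  qed
  ultimately show ?thesis
    using dim_sums_Int[OF center_subspace subspace_span[of "{d, e, f}"]] dual3_dim(1)[OF du]
    by simp
qed

text \<open>The test vectors \<open>ws\<close> may lie outside \<open>W\<close>. This is essential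
  for bases of the center, on which \<open>B\<close> vanishes.\<close>

lemma basis_of_if_dual:
  assumes "\<And>i j. i < length vs \<Longrightarrow> j < length vs \<Longrightarrow>
      B (ws ! i) (vs ! j) = (if i = j then 1 else 0)"
    and "set vs \<subseteq> W" "subspace W" "dim W \<le> length vs"
  shows "basis_of W vs"
proof -
  note ind = independent_if_dual[of vs ws, OF assms(1)]
  have "W \<subseteq> span (set vs)"
    using assms(2,4) ind by (intro card_ge_dim_independent) (auto simp: distinct_card)
  moreover have "span (set vs) \<subseteq> W" using assms(2,3) by (rule span_minimal)
  ultimately show ?thesis using ind by (auto simp: basis_of_def)
qed

lemma center_orthogonal_span_frame:
  assumes fr: "frame a b c" and z: "z \<in> center" and u: "u \<in> span {a, b, c}"
  shows "B z u = 0"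
proof -
  obtain d e f where du: "dual3 a b c d e f" using dual3_obtain[OF fr] .
  have "B z a = 0 \<and> B z b = 0 \<and> B z c = 0"
    using z center_frame[OF fr du] by (simp add: form_sym[of z])
  then show ?thesis using u by (auto simp: span_three form_simps)
qed

lemma span_frame_eq:
  assumes fr: "frame a b c" and "p \<in> span {a, b, c}" "q \<in> span {a, b, c}" "r \<in> span {a, b, c}"
    and "independent {p, q, r}" "card {p, q, r} = 3"
  shows "span {p, q, r} = span {a, b, c}"
proof -
  obtain d e f where du: "dual3 a b c d e f" using dual3_obtain[OF fr] .
  show ?thesis
    using assms dual3_dim(2)[OF du] dim_eq_card_independent[of "{p, q, r}"]
    by (intro subspace_dim_equal subspace_span span_minimal) auto
qed

section \<open>Adapted bases in dimensions six, five and four\<close>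

text \<open>The center has dimension 3, so it is the whole span of the frame; only the dual vectors
  need correcting.\<close>

lemma dim_six_basis:
  assumes "dim (UNIV :: 'v set) = 6"
  obtains z1 z2 z3 x1 x2 x3 where "frame z1 z2 z3" "dual3 z1 z2 z3 x1 x2 x3"
    "z1 \<in> center" "z2 \<in> center" "z3 \<in> center"
    "B x1 x1 = 0" "B x1 x2 = 0" "B x1 x3 = 0" "B x2 x2 = 0" "B x2 x3 = 0" "B x3 x3 = 0"
proof -
  obtain a b c where fr: "frame a b c"
    using frame_if_elementary[OF elementary] br_nonzero by blast
  obtain d e f where du: "dual3 a b c d e f" using dual3_obtain[OF fr] .
  have "center = span {a, b, c}"
    using center_subset_span_frame[OF fr du center_isotropic] dim_center_frame[OF fr]
      dual3_dim(2)[OF du] assms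
    by (intro subspace_dim_equal center_subspace subspace_span) auto
  then have mem: "a \<in> center" "b \<in> center" "c \<in> center" by (auto intro: span_base)
  then have iso: "B a a = 0" "B a b = 0" "B a c = 0" "B b a = 0" "B b b = 0" "B b c = 0"
      "B c a = 0" "B c b = 0" "B c c = 0"
    using center_isotropic by (auto simp: totally_isotropic_def)
  note du' = du[unfolded dual3_def]
  \<comment> \<open>Each of the two arguments of \<open>B (h d) (h e)\<close> contributes minus one
    half of \<open>B d e\<close>, so the corrected vectors are mutually orthogonal and isotropic.
    Pairings with the frame are unchanged because the correction is central.\<close>
  define h where "h w = w - (B w d / 2) *s a - (B w e / 2) *s b - (B w f / 2) *s c" for w
  have du2: "dual3 a b c (h d) (h e) (h f)"
    using iso du' by (simp add: dual3_def h_def form_simps)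
  have "B (h d) (h d) = 0" "B (h d) (h e) = 0" "B (h d) (h f) = 0"
      "B (h e) (h e) = 0" "B (h e) (h f) = 0" "B (h f) (h f) = 0"
    using iso du'
      form_sym[of d a] form_sym[of e a] form_sym[of f a] form_sym[of d b] form_sym[of e b]
      form_sym[of f b] form_sym[of d c] form_sym[of e c] form_sym[of f c] form_sym[of e d]
      form_sym[of f d] form_sym[of f e]
    by (simp_all add: h_def form_simps)
  with that[OF fr du2 mem] show ?thesis by blast
qed

text \<open>The center is a plane in the span of the frame, and the remaining direction is
  normalized to a unit vector \<open>t\<close>.\<close>

lemma dim_five_basis:
  assumes dim5: "dim (UNIV :: 'v set) = 5"
  obtains z1 z2 x1 x2 t where "frame z1 z2 t" "dual3 z1 z2 t x1 x2 t"
    "z1 \<in> center" "z2 \<in> center" "B x1 x1 = 0" "B x1 x2 = 0" "B x2 x2 = 0"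
proof -
  obtain a b c where fr: "frame a b c"
    using frame_if_elementary[OF elementary] br_nonzero by blast
  obtain d e f where du: "dual3 a b c d e f" using dual3_obtain[OF fr] .
  have dimc: "dim center = 2" using dim_center_frame[OF fr] dim5 by simp
  note sub = center_subset_span_frame[OF fr du center_isotropic]
  obtain S where S: "S \<subseteq> center" "independent S" "center \<subseteq> span S" "card S = 2"
    by (rule basis_exists[of center, unfolded dimc])
  obtain z1 z2 where Sz: "S = {z1, z2}" "z1 \<noteq> z2" using S(4) by (auto simp: card_2_iff)
  have z: "z1 \<in> center" "z2 \<in> center" using S(1) Sz by auto
  have spanz: "span {z1, z2} = center"
    using S Sz span_minimal[OF S(1) center_subspace] by auto
  \<comment> \<open>A non-central \<open>t\<close> completes a basis of the center to one of the
    span. Were it isotropic, it would be orthogonal to the whole frame and hence central.\<close>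
  have key: "span {z1, z2, t} = span {a, b, c} \<and> B t t \<noteq> 0"
    if t: "t \<in> span {a, b, c}" "t \<notin> center" for t
  proof -
    have "independent (insert t {z1, z2})"
      using S(2) Sz t spanz by (auto simp: independent_insert)
    moreover have "t \<noteq> z1" "t \<noteq> z2" using z t by auto
    ultimately have sp: "span {z1, z2, t} = span {a, b, c}"
      using Sz z sub t by (intro span_frame_eq[OF fr]) (auto simp: insert_commute)
    have zt: "B z1 t = 0" "B z2 t = 0"
      using center_orthogonal_span_frame[OF fr _ t(1)] z by auto
    have "B t t \<noteq> 0"
    proof
      assume tt: "B t t = 0"
      have "B u t = 0" if "u \<in> span {a, b, c}" for u
        using that zt tt unfolding sp[symmetric] span_three by (auto simp: form_simps)
      then have "B a t = 0" "B b t = 0" "B c t = 0" by (auto intro: span_base)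
      then show False using t center_frame[OF fr du] by simp
    qed
    then show ?thesis using sp by blast
  qed
  have "\<not> span {a, b, c} \<subseteq> center"
    using dim_subset[of "span {a, b, c}" center] dual3_dim(2)[OF du] dimc by auto
  then obtain t0 where t0: "t0 \<in> span {a, b, c}" "t0 \<notin> center" by blast
  define s where "s = csqrt (B t0 t0)"
  have s: "s * s = B t0 t0" "s \<noteq> 0"
    using key[OF t0] by (auto simp: s_def power2_csqrt[unfolded power2_eq_square])
  define t where "t = inverse s *s t0"
  have t0_eq: "t0 = s *s t" using s by (simp add: t_def)
  have t: "t \<in> span {a, b, c}" using t0 by (simp add: t_def span_scale)
  have "t \<notin> center" using t0 t0_eq subspace_scale[OF center_subspace, of t s] by metis
  note t = t this
  have tt: "B t t = 1" using s(2) by (simp add: t_def form_simps s(1)[symmetric] field_simps)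
  have "a \<in> span {z1, z2, t}" "b \<in> span {z1, z2, t}" "c \<in> span {z1, z2, t}"
    using key[OF t] by (auto intro: span_base)
  \<comment> \<open>The scalar goes to the central vector \<open>z1\<close>, so that
    \<open>t\<close> keeps length 1.\<close>
  then obtain k where k: "k \<noteq> 0" "frame (k *s z1) z2 t"
    using frame_change[OF fr] br_nonzero by blast
  define y where "y = k *s z1"
  have y: "y \<in> center" using z subspace_scale[OF center_subspace] by (simp add: y_def)
  have fr': "frame y z2 t" using k by (simp add: y_def)
  obtain d e f where "dual3 y z2 t d e f" using dual3_obtain[OF fr'] .
  note du' = this[unfolded dual3_def]
  have iso: "B y y = 0" "B y z2 = 0" "B z2 y = 0" "B z2 z2 = 0"
    using center_isotropic y z by (auto simp: totally_isotropic_def)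
  have orth: "B y t = 0" "B z2 t = 0" "B t y = 0" "B t z2 = 0"
    using center_orthogonal_span_frame[OF fr _ t(1)] y z form_sym[of t] by auto
  define h where "h w = w - (B w d / 2) *s y - (B w e / 2) *s z2" for w
  \<comment> \<open>The third dual vector \<open>f\<close> is replaced by \<open>t\<close>, a unit
    vector orthogonal to the center.\<close>
  have du2: "dual3 y z2 t (h d) (h e) t"
    using iso orth tt du' by (simp add: dual3_def h_def form_simps)
  have "B (h d) (h d) = 0" "B (h d) (h e) = 0" "B (h e) (h e) = 0"
    using iso du'
      form_sym[of d y] form_sym[of e y] form_sym[of d z2] form_sym[of e z2] form_sym[of e d]
    by (simp_all add: h_def form_simps)
  with that[OF fr' du2 y z(2)] show ?thesis by blast
qed

text \<open>Modulo the central line the span of the frame is a nondegenerate plane, so it has a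
  hyperbolic pair \<open>p\<close>, \<open>q\<close>. The order \<open>z\<close>, \<open>q\<close>,
  \<open>p\<close> of the frame fixes the signs of the brackets with \<open>x\<close>.\<close>

lemma dim_four_basis:
  assumes dim4: "dim (UNIV :: 'v set) = 4"
  obtains z x p q where "frame z q p" "dual3 z q p x p q" "z \<in> center"
    "B x x = 0" "B p p = 0" "B q q = 0"
proof -
  obtain a b c where fr: "frame a b c"
    using frame_if_elementary[OF elementary] br_nonzero by blast
  obtain d e f where du: "dual3 a b c d e f" using dual3_obtain[OF fr] .
  have dimc: "dim center = 1" using dim_center_frame[OF fr] dim4 by simp
  note sub = center_subset_span_frame[OF fr du center_isotropic]
  obtain S where S: "S \<subseteq> center" "independent S" "center \<subseteq> span S" "card S = 1"
    by (rule basis_exists[of center, unfolded dimc])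
  obtain z where Sz: "S = {z}" using S(4) by (auto simp: card_1_singleton_iff)
  have z: "z \<in> center" using S(1) Sz by auto
  have spanz: "span {z} = center"
    using S Sz span_minimal[OF S(1) center_subspace] by auto
  have "\<exists>p \<in> span {a, b, c}. p \<notin> center \<and> B p p = 0"
  proof -
    have "\<not> span {a, b, c} \<subseteq> center"
      using dim_subset[of "span {a, b, c}" center] dual3_dim(2)[OF du] dimc by auto
    then obtain u where u: "u \<in> span {a, b, c}" "u \<notin> center" by blast
    have "dim {z, u} \<le> 2" using dim_le_card'[of "{z, u}"] card_insert_le_m1[of 2 "{u}" z] by simp
    then have "\<not> span {a, b, c} \<subseteq> span {z, u}"
      using dim_subset[of "span {a, b, c}" "span {z, u}"] dual3_dim(2)[OF du] by auto
    \<comment> \<open>Together with \<open>z\<close> and \<open>u\<close> this \<open>v\<close> is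
      independent, so no \<open>s *s u + v\<close> is central.\<close>
    then obtain v where v: "v \<in> span {a, b, c}" "v \<notin> span {z, u}" by blast
    show ?thesis
    proof (cases "B u u = 0")
      case True
      then show ?thesis using u by blast
    next
      case False
      define r where "r = csqrt (B u v * B u v - B u u * B v v)"
      \<comment> \<open>A root of the quadratic polynomial
        \<open>B (s *s u + v) (s *s u + v)\<close> in \<open>s\<close>; its leading coefficient
        \<open>B u u\<close> is non-zero here.\<close>
      define s where "s = (r - B u v) / B u u"
      have r: "r * r = B u v * B u v - B u u * B v v"
        by (simp add: r_def power2_csqrt[unfolded power2_eq_square])
      have s: "s * B u u = r - B u v" using False by (simp add: s_def)
      define p where "p = s *s u + v"
      have "B u u * B p p = (s * B u u) * (s * B u u) + 2 * (s * B u u) * B u v + B u u * B v v"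
        by (simp add: p_def form_simps form_sym[of v u] algebra_simps)
      also have "\<dots> = 0" unfolding s using r by (simp add: algebra_simps)
      finally have "B p p = 0" using False by simp
      moreover have "p \<notin> center"
      proof
        assume "p \<in> center"
        then have "p \<in> span {z, u}" using spanz span_mono[of "{z}" "{z, u}"] by auto
        then have "p - s *s u \<in> span {z, u}" by (auto intro!: span_diff span_scale intro: span_base)
        then show False using v by (simp add: p_def)
      qed
      moreover have "p \<in> span {a, b, c}" using u v by (simp add: p_def span_add span_scale)
      ultimately show ?thesis by blast
    qed
  qed
  then obtain p where p: "p \<in> span {a, b, c}" "p \<notin> center" "B p p = 0" by blast
  have "\<exists>w \<in> span {a, b, c}. B p w \<noteq> 0"
    using p(2) center_frame[OF fr du] form_sym[of p] by (auto intro: span_base)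
  then obtain w where w: "w \<in> span {a, b, c}" "B p w \<noteq> 0" by blast
  \<comment> \<open>Scaling makes the pairing with \<open>p\<close> equal to 1; subtracting a
    multiple of the isotropic \<open>p\<close> then makes \<open>q\<close> isotropic without
    changing that pairing.\<close>
  define q0 where "q0 = inverse (B p w) *s w"
  define q where "q = q0 - (B q0 q0 / 2) *s p"
  have q0: "q0 \<in> span {a, b, c}" "B p q0 = 1" "B q0 p = 1"
    using w form_sym[of q0 p] by (auto simp: q0_def form_simps intro: span_scale)
  have q: "q \<in> span {a, b, c}" "B p q = 1" "B q q = 0" "B q p = 1"
    using q0 p by (auto simp: q_def form_simps intro!: span_diff span_scale)
  have zp: "B z p = 0" "B p z = 0" "B z q = 0" "B q z = 0"
    using center_orthogonal_span_frame[OF fr z] p q form_sym[of _ z] by auto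
  \<comment> \<open>Pairing with \<open>p\<close> gives 1 on \<open>q\<close> but 0 on
    \<open>p\<close> and \<open>z\<close>.\<close>
  have "q \<notin> span {p, z}"
    using q(4) p(3) zp by (auto simp: span_two form_simps)
  moreover have "independent {p, z}"
    using S(2) Sz p spanz by (auto simp: independent_insert)
  ultimately have "independent {q, p, z}" by (rule independent_insertI)
  moreover have "card {z, q, p} = 3"
    using p q zp z by (auto simp: card_insert_if)
  ultimately have "span {z, q, p} = span {a, b, c}"
    using z sub p q by (intro span_frame_eq[OF fr]) (auto simp: insert_commute)
  then have "a \<in> span {z, q, p}" "b \<in> span {z, q, p}" "c \<in> span {z, q, p}"
    by (auto intro: span_base)
  then obtain k where k: "k \<noteq> 0" "frame (k *s z) q p"
    using frame_change[OF fr] br_nonzero by blast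
  define y where "y = k *s z"
  have y: "y \<in> center" using z subspace_scale[OF center_subspace] by (simp add: y_def)
  have fr': "frame y q p" using k by (simp add: y_def)
  obtain d e f where "dual3 y q p d e f" using dual3_obtain[OF fr'] .
  note du' = this[unfolded dual3_def]
  have orth: "B y y = 0" "B y p = 0" "B y q = 0" "B p y = 0" "B q y = 0"
    using zp center_isotropic y z by (auto simp: totally_isotropic_def y_def form_simps)
  \<comment> \<open>A central correction, chosen so that \<open>x\<close> is isotropic and pairs
    with the frame as \<open>d\<close> does.\<close>
  define x where "x = d - (B d d / 2) *s y"
  have du2: "dual3 y q p x p q"
    using orth p q du' by (simp add: dual3_def x_def form_simps)
  have "B x x = 0"
    using orth du' by (simp add: x_def form_simps form_sym[of d y])
  with that[OF fr' du2 y] p(3) q(3) show ?thesis by blast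
qed

section \<open>Bracket relations in the adapted bases\<close>

lemma dim_six_normal_form:
  assumes dim6: "dim (UNIV :: 'v set) = 6"
  shows "\<exists>Z X :: nat \<Rightarrow> 'v.
    basis_of UNIV [Z 1, Z 2, Z 3, X 1, X 2, X 3] \<and> basis_of center [Z 1, Z 2, Z 3] \<and>
    (\<forall>i\<in>{1,2,3}. \<forall>j\<in>{1,2,3}. B (Z i) (Z j) = 0 \<and> B (X i) (X j) = 0 \<and>
      B (Z i) (X j) = (if i = j then 1 else 0)) \<and>
    br (X 1) (X 2) = Z 3 \<and> br (X 2) (X 3) = Z 1 \<and> br (X 3) (X 1) = Z 2 \<and>
    (\<forall>i\<in>{1,2,3}. \<forall>j\<in>{1,2,3}. br (Z i) (Z j) = 0 \<and> br (Z i) (X j) = 0)"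
proof -
  obtain z1 z2 z3 x1 x2 x3 where fr: "frame z1 z2 z3" and du: "dual3 z1 z2 z3 x1 x2 x3"
    and z: "z1 \<in> center" "z2 \<in> center" "z3 \<in> center"
    and x: "B x1 x1 = 0" "B x1 x2 = 0" "B x1 x3 = 0" "B x2 x2 = 0" "B x2 x3 = 0" "B x3 x3 = 0"
    using dim_six_basis[OF dim6] .
  have zz: "B u v = 0" if "u \<in> center" "v \<in> center" for u v
    using center_isotropic that by (simp add: totally_isotropic_def)
  have xz: "B x1 z1 = 1" "B x1 z2 = 0" "B x1 z3 = 0" "B x2 z1 = 0" "B x2 z2 = 1" "B x2 z3 = 0"
      "B x3 z1 = 0" "B x3 z2 = 0" "B x3 z3 = 1" and xx: "B x2 x1 = 0" "B x3 x1 = 0" "B x3 x2 = 0"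
    using du x by (simp_all add: dual3_def form_sym)
  note forms = du[unfolded dual3_def] x xx xz zz[OF z(1) z(1)] zz[OF z(1) z(2)] zz[OF z(1) z(3)]
    zz[OF z(2) z(1)] zz[OF z(2) z(2)] zz[OF z(2) z(3)]
    zz[OF z(3) z(1)] zz[OF z(3) z(2)] zz[OF z(3) z(3)]
  have br0: "br u v = 0" if "u \<in> center" for u v using that by (simp add: center_def)
  have "basis_of UNIV [z1, z2, z3, x1, x2, x3]"
    using dim6 forms
    \<comment> \<open>The dual family is the basis itself with the two halves exchanged.\<close>
    by (intro basis_of_if_dual[where ws = "[x1, x2, x3, z1, z2, z3]"]) (auto simp: less_Suc_eq)
  moreover have "basis_of center [z1, z2, z3]"
    using dim_center_frame[OF fr] dim6 z forms
    by (intro basis_of_if_dual[where ws = "[x1, x2, x3]"]) (auto simp: less_Suc_eq center_subspace)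
  moreover have "br x1 x2 = z3" "br x2 x3 = z1" "br x3 x1 = z2"
    using forms by (simp_all add: br_frame[OF fr])
  ultimately show ?thesis using forms z
    \<comment> \<open>The default value of each function serves index 1; indices outside 1 to 3 do
      not occur in the claim.\<close>
    by (intro exI[of _ "(\<lambda>_. z1)(2 := z2, 3 := z3)"] exI[of _ "(\<lambda>_. x1)(2 := x2, 3 := x3)"])
       (simp add: br0)
qed

lemma dim_five_normal_form:
  assumes dim5: "dim (UNIV :: 'v set) = 5"
  shows "\<exists>(Z :: nat \<Rightarrow> 'v) (X :: nat \<Rightarrow> 'v) T.
    basis_of UNIV [Z 1, Z 2, X 1, X 2, T] \<and> basis_of center [Z 1, Z 2] \<and>
    (\<forall>i\<in>{1,2}. \<forall>j\<in>{1,2}. B (Z i) (Z j) = 0 \<and> B (X i) (X j) = 0 \<and>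
      B (Z i) (X j) = (if i = j then 1 else 0)) \<and>
    (\<forall>i\<in>{1,2}. B T (Z i) = 0 \<and> B T (X i) = 0) \<and> B T T = 1 \<and>
    br (X 1) T = - Z 2 \<and> br (X 2) T = Z 1 \<and> br (X 1) (X 2) = T \<and>
    (\<forall>i\<in>{1,2}. \<forall>j\<in>{1,2}. br (Z i) (Z j) = 0 \<and> br (Z i) (X j) = 0 \<and> br (Z i) T = 0)"
proof -
  obtain z1 z2 x1 x2 t where fr: "frame z1 z2 t" and du: "dual3 z1 z2 t x1 x2 t"
    and z: "z1 \<in> center" "z2 \<in> center" and x: "B x1 x1 = 0" "B x1 x2 = 0" "B x2 x2 = 0"
    using dim_five_basis[OF dim5] .
  have zz: "B u v = 0" if "u \<in> center" "v \<in> center" for u v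
    using center_isotropic that by (simp add: totally_isotropic_def)
  have sym: "B x1 z1 = 1" "B x1 z2 = 0" "B x2 z1 = 0" "B x2 z2 = 1" "B x2 x1 = 0"
      "B t z1 = 0" "B t z2 = 0" "B x1 t = 0" "B x2 t = 0"
    using du x by (simp_all add: dual3_def form_sym)
  note forms = du[unfolded dual3_def] x sym zz[OF z(1) z(1)] zz[OF z(1) z(2)]
    zz[OF z(2) z(1)] zz[OF z(2) z(2)]
  have br0: "br u v = 0" if "u \<in> center" for u v using that by (simp add: center_def)
  have "basis_of UNIV [z1, z2, x1, x2, t]"
    using dim5 forms
    by (intro basis_of_if_dual[where ws = "[x1, x2, z1, z2, t]"]) (auto simp: less_Suc_eq)
  moreover have "basis_of center [z1, z2]"
    using dim_center_frame[OF fr] dim5 z forms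
    by (intro basis_of_if_dual[where ws = "[x1, x2]"]) (auto simp: less_Suc_eq center_subspace)
  moreover have "br x1 t = - z2" "br x2 t = z1" "br x1 x2 = t"
    using forms by (simp_all add: br_frame[OF fr])
  ultimately show ?thesis using forms z
    by (intro exI[of _ "(\<lambda>_. z1)(2 := z2)"] exI[of _ "(\<lambda>_. x1)(2 := x2)"] exI[of _ t])
       (simp add: br0)
qed

lemma dim_four_normal_form:
  assumes dim4: "dim (UNIV :: 'v set) = 4"
  shows "dim center = 1 \<and> (\<exists>I I' Z P X Q.
    totally_isotropic I \<and> totally_isotropic I' \<and> basis_of I [Z, P] \<and> basis_of I' [X, Q] \<and>
    center \<subseteq> I \<and> I \<subseteq> derived \<and> direct_sum UNIV I I' \<and> center = {c *s Z | c. True} \<and>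
    B Z X = 1 \<and> B P Q = 1 \<and> B Z Q = 0 \<and> B X P = 0 \<and>
    br X P = P \<and> br X Q = - Q \<and> br P Q = Z \<and> br Z P = 0 \<and> br Z X = 0 \<and> br Z Q = 0)"
proof -
  obtain z x p q where fr: "frame z q p" and du: "dual3 z q p x p q" and z: "z \<in> center"
    and iso: "B x x = 0" "B p p = 0" "B q q = 0"
    using dim_four_basis[OF dim4] .
  have dimc: "dim center = 1" using dim_center_frame[OF fr] dim4 by simp
  have zz: "B z z = 0" using center_isotropic z by (simp add: totally_isotropic_def)
  have sym: "B x z = 1" "B p z = 0" "B q z = 0" "B x q = 0" "B x p = 0"
    using du by (simp_all add: dual3_def form_sym)
  note forms = du[unfolded dual3_def] iso sym zz
  have br0: "br z v = 0" for v using z by (simp add: center_def)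
  have brs: "br x p = p" "br x q = - q" "br p q = z"
    using forms by (simp_all add: br_frame[OF fr])
  have "basis_of center [z]"
    using dimc z forms
    by (intro basis_of_if_dual[where ws = "[x]"]) (auto simp: center_subspace)
  then have center: "center = span {z}" by (simp add: basis_of_def)
  have "distinct [z, p] \<and> independent (set [z, p])"
    using forms by (intro conjI independent_if_dual[where ws = "[x, q]"]) (auto simp: less_Suc_eq)
  then have I: "basis_of (span {z, p}) [z, p]" by (simp add: basis_of_def)
  have "distinct [x, q] \<and> independent (set [x, q])"
    using forms by (intro conjI independent_if_dual[where ws = "[z, p]"]) (auto simp: less_Suc_eq)
  then have I': "basis_of (span {x, q}) [x, q]" by (simp add: basis_of_def)
  have "totally_isotropic (span {z, p})" "totally_isotropic (span {x, q})"
    using forms by (auto simp: totally_isotropic_def span_two form_simps)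
  moreover have "center \<subseteq> span {z, p}" unfolding center by (rule span_mono) simp
  \<comment> \<open>Both generators are brackets: \<open>z\<close> is \<open>br p q\<close> and
    \<open>p\<close> is \<open>br x p\<close>.\<close>
  moreover have "span {z, p} \<subseteq> derived"
    unfolding derived_def using brs by (intro span_mono) (auto, metis+)
  moreover have "direct_sum UNIV (span {z, p}) (span {x, q})"
  proof -
    have "u = 0" if mem: "u \<in> span {z, p}" "u \<in> span {x, q}" for u
    proof -
      obtain k l where "u = k *s z + l *s p" using mem(1) unfolding span_two by blast
      \<comment> \<open>These pairings are also the coordinates of \<open>u\<close> with respect to
        \<open>x\<close> and \<open>q\<close>, so both coordinates vanish.\<close>
      then have "B z u = 0" "B p u = 0" using forms by (simp_all add: form_simps)
      moreover obtain m n where u: "u = m *s x + n *s q" using mem(2) unfolding span_two by blast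
      ultimately show "u = 0" using forms by (simp add: form_simps)
    qed
    moreover have "v \<in> {u + w | u w. u \<in> span {z, p} \<and> w \<in> span {x, q}}" for v
    proof -
      \<comment> \<open>The projection of \<open>v\<close> onto the center. The \<open>p\<close>
        component is added back on the side of \<open>span {z, p}\<close>, the other two form the
        part in \<open>span {x, q}\<close>.\<close>
      define u where "u = v - B z v *s x - B q v *s p - B p v *s q"
      have "u \<in> span {z, p}"
        using minus_dual_in_center[OF fr du, of v] \<open>center \<subseteq> span {z, p}\<close> by (auto simp: u_def)
      then have "u + B q v *s p \<in> span {z, p}" by (auto intro!: span_add span_scale intro: span_base)
      moreover have "B z v *s x + B p v *s q \<in> span {x, q}" unfolding span_two by blast
      moreover have "v = (u + B q v *s p) + (B z v *s x + B p v *s q)" by (simp add: u_def)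
      ultimately show ?thesis by blast
    qed
    ultimately show ?thesis
      using span_zero by (auto simp: direct_sum_def)
  qed
  moreover have "center = {c *s z | c. True}" by (auto simp: center span_singleton)
  moreover have "B z x = 1" "B p q = 1" "B z q = 0" "B x p = 0" using forms by blast+
  ultimately show ?thesis using dimc I I' brs br0
    by (intro conjI exI[of _ "span {z, p}"] exI[of _ "span {x, q}"]
        exI[of _ z] exI[of _ p] exI[of _ x] exI[of _ q]) (assumption | rule br0)+
qed

end

theorem proposition6p3p2:
  fixes scale :: "complex \<Rightarrow> 'v::ab_group_add \<Rightarrow> 'v"
    and br :: "'v \<Rightarrow> 'v \<Rightarrow> 'v"
    and B :: "'v \<Rightarrow> 'v \<Rightarrow> complex"
    and Basis :: "'v set"
  assumes "quadratic_lie_algebra scale br B"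
    and "finite_dimensional_vector_space scale Basis"
    and "quadratic_lie_algebra.elementary scale br B"
    and "lie_algebra.center br \<noteq> {0}"
    and "quadratic_lie_algebra.totally_isotropic scale B (lie_algebra.center br)"
  shows
    "(vector_space.dim scale (UNIV :: 'v set) = 6 \<longrightarrow>
       (\<exists>Z X :: nat \<Rightarrow> 'v.
          lie_algebra.basis_of scale UNIV [Z 1, Z 2, Z 3, X 1, X 2, X 3] \<and>
          lie_algebra.basis_of scale (lie_algebra.center br) [Z 1, Z 2, Z 3] \<and>
          (\<forall>i\<in>{1,2,3}. \<forall>j\<in>{1,2,3}.
             B (Z i) (Z j) = 0 \<and> B (X i) (X j) = 0 \<and>
             B (Z i) (X j) = (if i = j then 1 else 0)) \<and>
          br (X 1) (X 2) = Z 3 \<and> br (X 2) (X 3) = Z 1 \<and> br (X 3) (X 1) = Z 2 \<and>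
          (\<forall>i\<in>{1,2,3}. \<forall>j\<in>{1,2,3}. br (Z i) (Z j) = 0 \<and> br (Z i) (X j) = 0)))
     \<and>
     (vector_space.dim scale (UNIV :: 'v set) = 5 \<longrightarrow>
       (\<exists>(Z :: nat \<Rightarrow> 'v) (X :: nat \<Rightarrow> 'v) T.
          lie_algebra.basis_of scale UNIV [Z 1, Z 2, X 1, X 2, T] \<and>
          lie_algebra.basis_of scale (lie_algebra.center br) [Z 1, Z 2] \<and>
          (\<forall>i\<in>{1,2}. \<forall>j\<in>{1,2}.
             B (Z i) (Z j) = 0 \<and> B (X i) (X j) = 0 \<and>
             B (Z i) (X j) = (if i = j then 1 else 0)) \<and>
          (\<forall>i\<in>{1,2}. B T (Z i) = 0 \<and> B T (X i) = 0) \<and>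
          B T T = 1 \<and>
          br (X 1) T = - Z 2 \<and> br (X 2) T = Z 1 \<and> br (X 1) (X 2) = T \<and>
          (\<forall>i\<in>{1,2}. \<forall>j\<in>{1,2}.
             br (Z i) (Z j) = 0 \<and> br (Z i) (X j) = 0 \<and> br (Z i) T = 0)))
     \<and>
     (vector_space.dim scale (UNIV :: 'v set) = 4 \<longrightarrow>
       vector_space.dim scale (lie_algebra.center br) = 1 \<and>
       (\<exists>I I' Z P X Q.
          quadratic_lie_algebra.totally_isotropic scale B I \<and> quadratic_lie_algebra.totally_isotropic scale B I' \<and>
          lie_algebra.basis_of scale I [Z, P] \<and> lie_algebra.basis_of scale I' [X, Q] \<and>
          lie_algebra.center br \<subseteq> I \<and> I \<subseteq> lie_algebra.derived scale br \<and>
          lie_algebra.direct_sum scale UNIV I I' \<and>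
          lie_algebra.center br = {scale c Z | c. True} \<and>
          B Z X = 1 \<and> B P Q = 1 \<and> B Z Q = 0 \<and> B X P = 0 \<and>
          br X P = P \<and> br X Q = - Q \<and> br P Q = Z \<and>
          br Z P = 0 \<and> br Z X = 0 \<and> br Z Q = 0))"
proof -
  interpret isotropic_center scale br B Basis
    using assms by (simp add: isotropic_center_def isotropic_center_axioms_def)
  show ?thesis
    using dim_six_normal_form dim_five_normal_form dim_four_normal_form by (intro conjI impI) simp_all
qed

end
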